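(* Let $\boldsymbol{x}:U\to H^3$ be a smooth surface (a smooth map, possibly with singular points). Then $\boldsymbol{x}$ is a hyperbolic generalized framed base surface if and only if there exists a smooth map $\boldsymbol{\nu}:U\to S_1^3$ such that $\langle \boldsymbol{x},\boldsymbol{\nu}\rangle(u,v)=\langle \boldsymbol{x}\wedge\boldsymbol{x}_u\wedge\boldsymbol{x}_v,\boldsymbol{\nu}\rangle(u,v)=0$ for all $(u,v)\in U$.
   Context: $\mathbb{R}^4_1$ is $\mathbb{R}^4$ with the pseudo inner product $\langle \boldsymbol{x},\boldsymbol{y}\rangle=-x_1y_1+x_2y_2+x_3y_3+x_4y_4$. The pseudo vector product $\boldsymbol{x}\wedge\boldsymbol{y}\wedge\boldsymbol{z}$ of three vectors of $\mathbb{R}^4_1$ is the unique vector with $\langle \boldsymbol{w},\boldsymbol{x}\wedge\boldsymbol{y}\wedge\boldsymbol{z}\rangle=\det(\boldsymbol{w},\boldsymbol{x},\boldsymbol{y},\boldsymbol{z})$ for all $\boldsymbol{w}\in\mathbb{R}^4_1$. $H^3=\{\boldsymbol{x}\in\mathbb{R}^4_1: \langle\boldsymbol{x},\boldsymbol{x}\rangle=-1,\ x_1>0\}$, $S^3_1=\{\boldsymbol{x}\in\mathbb{R}^4_1:\langle\boldsymbol{x},\boldsymbol{x}\rangle=1\}$, $\Delta_5=\{(\boldsymbol{\nu}_1,\boldsymbol{\nu}_2)\in S^3_1\times S^3_1:\langle\boldsymbol{\nu}_1,\boldsymbol{\nu}_2\rangle=0\}$. $U$ is a simply connected open subset of $\mathbb{R}^2$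 with coordinates $(u,v)$; subscripts $u,v$ denote partial derivatives; all maps are $C^\infty$. A smooth map $(\boldsymbol{x},\boldsymbol{\nu}_1,\boldsymbol{\nu}_2):U\to H^3\times\Delta_5$ is a hyperbolic generalized framed surface if $\langle\boldsymbol{x},\boldsymbol{\nu}_1\rangle=\langle\boldsymbol{x},\boldsymbol{\nu}_2\rangle=0$ on $U$ and there are smooth functions $\alpha,\beta:U\to\mathbb{R}$ with $\boldsymbol{x}\wedge\boldsymbol{x}_u\wedge\boldsymbol{x}_v=\alpha\boldsymbol{\nu}_1+\beta\boldsymbol{\nu}_2$ on $U$. A smooth map $\boldsymbol{x}:U\to H^3$ is a hyperbolic generalized framed base surface if there is a smooth $(\boldsymbol{\nu}_1,\boldsymbol{\nu}_2):U\to\Delta_5$ such that $(\boldsymbol{x},\boldsymbol{\nu}_1,\boldsymbol{\nu}_2)$ is a hyperbolic generalized framed surface. *)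

theory Defs
  imports "HOL-Analysis.Analysis"
begin

primrec Ck_on :: "nat \<Rightarrow> ('a::euclidean_space \<Rightarrow> 'b::real_normed_vector) \<Rightarrow> 'a set \<Rightarrow> bool" where
  "Ck_on 0 f U \<longleftrightarrow> continuous_on U f"
| "Ck_on (Suc k) f U \<longleftrightarrow>
     (\<forall>p\<in>U. f differentiable (at p)) \<and>
     (\<forall>h. Ck_on k (\<lambda>p. frechet_derivative f (at p) h) U)"

(* Meaningful for open U only: the derivatives are taken at p, not at p within U. *)
definition smooth_on :: "('a::euclidean_space \<Rightarrow> 'b::real_normed_vector) \<Rightarrow> 'a set \<Rightarrow> bool" where
  "smooth_on f U \<longleftrightarrow> (\<forall>k. Ck_on k f U)"

definition partial_u :: "(real \<times> real \<Rightarrow> 'b::real_normed_vector) \<Rightarrow> real \<times> real \<Rightarrow> 'b" where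
  "partial_u f p = vector_derivative (\<lambda>s. f (s, snd p)) (at (fst p))"

definition partial_v :: "(real \<times> real \<Rightarrow> 'b::real_normed_vector) \<Rightarrow> real \<times> real \<Rightarrow> 'b" where
  "partial_v f p = vector_derivative (\<lambda>t. f (fst p, t)) (at (snd p))"

definition pinner :: "real^4 \<Rightarrow> real^4 \<Rightarrow> real" where
  "pinner x y = - (x$1 * y$1) + x$2 * y$2 + x$3 * y$3 + x$4 * y$4"

definition pcross :: "real^4 \<Rightarrow> real^4 \<Rightarrow> real^4 \<Rightarrow> real^4" where
  "pcross x y z = (THE a. \<forall>w. pinner w a = det (vector [w, x, y, z] :: real^4^4))"

definition H3 :: "(real^4) set" where
  "H3 = {x. pinner x x = -1 \<and> x$1 > 0}"

definition S31 :: "(real^4) set" where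
  "S31 = {x. pinner x x = 1}"

definition Delta5 :: "((real^4) \<times> (real^4)) set" where
  "Delta5 = {(n1, n2). n1 \<in> S31 \<and> n2 \<in> S31 \<and> pinner n1 n2 = 0}"

definition hyp_gen_framed_surface ::
  "(real \<times> real) set \<Rightarrow> (real \<times> real \<Rightarrow> real^4) \<Rightarrow> (real \<times> real \<Rightarrow> real^4) \<Rightarrow>
   (real \<times> real \<Rightarrow> real^4) \<Rightarrow> bool" where
  "hyp_gen_framed_surface U x n1 n2 \<longleftrightarrow>
     smooth_on x U \<and> smooth_on n1 U \<and> smooth_on n2 U \<and>
     (\<forall>p\<in>U. x p \<in> H3 \<and> (n1 p, n2 p) \<in> Delta5) \<and>
     (\<forall>p\<in>U. pinner (x p) (n1 p) = 0 \<and> pinner (x p) (n2 p) = 0) \<and>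
     (\<exists>\<alpha> \<beta> :: real \<times> real \<Rightarrow> real. smooth_on \<alpha> U \<and> smooth_on \<beta> U \<and>
        (\<forall>p\<in>U. pcross (x p) (partial_u x p) (partial_v x p) = \<alpha> p *\<^sub>R n1 p + \<beta> p *\<^sub>R n2 p))"

definition hyp_gen_framed_base_surface ::
  "(real \<times> real) set \<Rightarrow> (real \<times> real \<Rightarrow> real^4) \<Rightarrow> bool" where
  "hyp_gen_framed_base_surface U x \<longleftrightarrow>
     smooth_on x U \<and> x ` U \<subseteq> H3 \<and> (\<exists>n1 n2. hyp_gen_framed_surface U x n1 n2)"

text \<open>The description in \<^term>\<open>pcross\<close> does determine a vector:\<close>

lemma vector_4:
  "(vector [a, b, c, d] :: 'a::zero^4) $ 1 = a"
  "(vector [a, b, c, d] :: 'a::zero^4) $ 2 = b"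
  "(vector [a, b, c, d] :: 'a::zero^4) $ 3 = c"
  "(vector [a, b, c, d] :: 'a::zero^4) $ 4 = d"
  by (simp_all add: vector_def)

lemma pinner_eqI:
  assumes "\<And>w. pinner w a = pinner w b"
  shows "a = b"
proof -
  have "a $ i = b $ i" for i :: 4
    using assms[of "axis i 1"] exhaust_4[of i] by (auto simp: pinner_def axis_def)
  then show ?thesis by (simp add: vec_eq_iff)
qed

lemma pinner_pcross: "pinner w (pcross x y z) = det (vector [w, x, y, z] :: real^4^4)"
proof -
  define D where "D w = det (vector [w, x, y, z] :: real^4^4)" for w
  define M where "M = (vector [0, x, y, z] :: real^4^4)"
  have upd: "D w = det (\<chi> i. if i = 1 then w else M $ i)" for w
  proof -
    have "(vector [w, x, y, z] :: real^4^4) $ i = (if i = 1 then w else M $ i)" for i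
      using exhaust_4[of i] by (auto simp: vector_4 M_def)
    then have "(vector [w, x, y, z] :: real^4^4) = (\<chi> i. if i = 1 then w else M $ i)"
      by (intro vec_eq_iff[THEN iffD2] allI) (simp only: vec_lambda_beta)
    then show ?thesis by (simp only: D_def)
  qed
  have add: "D (v + w) = D v + D w" for v w
    unfolding upd by (rule det_row_add)
  have scale: "D (c *s w) = c * D w" for c w
    unfolding upd by (rule det_row_mul)
  define a :: "real^4" where
    "a = vector [- D (axis 1 1), D (axis 2 1), D (axis 3 1), D (axis 4 1)]"
  have "pinner w a = D w" for w
  proof -
    have "w = w$1 *s axis 1 1 + w$2 *s axis 2 1 + w$3 *s axis 3 1 + w$4 *s axis 4 1"
      by (simp add: vec_eq_iff forall_4 axis_def)
    then have "D w = D (w$1 *s axis 1 1 + w$2 *s axis 2 1 + w$3 *s axis 3 1 + w$4 *s axis 4 1)"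
      by (rule arg_cong)
    also have "\<dots> = w$1 * D (axis 1 1) + w$2 * D (axis 2 1) + w$3 * D (axis 3 1) + w$4 * D (axis 4 1)"
      by (simp only: add scale)
    finally show ?thesis by (simp add: pinner_def a_def vector_4)
  qed
  then have "\<exists>!a. \<forall>w. pinner w a = D w"
    by (intro ex1I[of _ a]) (auto intro: pinner_eqI)
  then have "\<forall>w. pinner w (THE a. \<forall>w. pinner w a = D w) = D w"
    by (rule theI')
  then show ?thesis by (simp add: pcross_def D_def)
qed

end

theory Submission
  imports Defs "HOL-Complex_Analysis.Riemann_Mapping"
begin

text \<open>
  For \<open>x\<close> in \<open>H3\<close> the pseudo-orthogonal complement of \<open>x\<close> is the tangent space of hyperbolic space
  at \<open>x\<close>, a Euclidean space of dimension three. The Lorentz boost that takes \<open>(1, 0, 0, 0)\<close> to \<open>x\<close>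
  identifies it isometrically with \<open>real^3\<close>, smoothly in \<open>x\<close> (\<open>pinner_boost\<close>, \<open>boost_unboost\<close>). Thus
  the fields orthogonal to \<open>x\<close> become maps from \<open>U\<close> to \<open>real^3\<close>. The vector \<open>X\<close>, the pseudo vector product of \<open>x\<close> and its two partial derivatives, is orthogonal to
  \<open>x\<close> and becomes such a map too.

  If \<open>(x, n1, n2)\<close> is a framed surface, then \<open>X\<close> lies in the plane of \<open>n1\<close> and \<open>n2\<close>, and the
  Euclidean cross product of their images in \<open>real^3\<close> is the required unit field \<open>n\<close>.

  Conversely, let \<open>m\<close>, with values in the unit sphere of \<open>real^3\<close>, be the image of the given \<open>n\<close>. A
  smooth unit field \<open>e\<close> orthogonal to \<open>m\<close> gives the orthonormal frame \<open>e\<close>, \<open>m \<times> e\<close> of the plane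
  orthogonal to \<open>m\<close>, in which \<open>X\<close> lies; its coefficients are inner products, hence smooth. So all
  depends on the existence of \<open>e\<close>, that is, of a nowhere vanishing section of the pullback of the
  tangent bundle of the sphere under \<open>m\<close>. That bundle is not trivial, and this is where simple
  connectedness is used.

  By the Riemann mapping theorem a nonempty \<open>U\<close> is, up to a diffeomorphism, the plane or the open unit disc, so
  it is starlike about \<open>0\<close>, and \<open>m\<close> is joined to a constant map by the maps \<open>p \<mapsto> m (t p)\<close>. For a
  constant map \<open>e\<close> exists. It is carried along the homotopy in small steps: if \<open>f\<close> and \<open>g\<close> are
  unit fields that are nowhere antipodal, the rotation that takes \<open>f p\<close> to \<open>g p\<close> in the plane of these
  two vectors takes a unit normal field of \<open>f\<close> to one of \<open>g\<close>, and it is a rational expression in the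
  data, hence smooth (\<open>unit_normal_field_step\<close>). Finitely many steps suffice on a compact set. As the
  domain is not compact, the factor \<open>t\<close> is replaced by a sequence of smooth functions
  \<open>s j\<close> that are \<open>1\<close> on the \<open>j\<close>-th set of a compact exhaustion and vanish far out.
  Passing from \<open>s j\<close> to \<open>s (Suc j)\<close> takes finitely many steps and changes nothing where the two agree,
  so that the fields obtained are locally stationary in \<open>j\<close> and have a smooth limit
  (\<open>unit_normal_field_exists\<close>).
\<close>

section \<open>Calculus of smooth maps on open sets\<close>

lemma Ck_on_SucD:
  assumes "Ck_on (Suc k) f U"
  shows "p \<in> U \<Longrightarrow> (f has_derivative frechet_derivative f (at p)) (at p)"
    and "Ck_on k (\<lambda>p. frechet_derivative f (at p) h) U"
  using assms by (auto simp: frechet_derivative_works)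

text \<open>The values of a function outside an open set do not affect its derivatives inside. This lets
  a derivative be replaced by a formula that holds on the set only.\<close>

lemma Ck_on_cong:
  fixes f g :: "'a::euclidean_space \<Rightarrow> 'b::real_normed_vector"
  assumes "open U" "Ck_on k f U" "\<And>p. p \<in> U \<Longrightarrow> f p = g p"
  shows "Ck_on k g U"
  using assms(2,3)
proof (induction k arbitrary: f g)
  case 0
  then show ?case by (simp cong: continuous_on_cong)
next
  case (Suc k)
  have der: "(g has_derivative frechet_derivative f (at p)) (at p)" if "p \<in> U" for p
    using has_derivative_transform_within_open[OF Ck_on_SucD(1)[OF Suc.prems(1) that] \<open>open U\<close> that]
      Suc.prems(2) by blast
  then have "frechet_derivative f (at p) = frechet_derivative g (at p)" if "p \<in> U" for p
    using frechet_derivative_at that by blast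
  then have "Ck_on k (\<lambda>p. frechet_derivative g (at p) h) U" for h
    using Suc.IH[OF Ck_on_SucD(2)[OF Suc.prems(1)]] by simp
  then show ?case
    using der by (auto intro: differentiableI)
qed

text \<open>The form in which a derivative known by a differentiation rule enters the inductions on the
  order of differentiability below.\<close>

lemma Ck_on_derivI:
  assumes "open U" "\<And>p. p \<in> U \<Longrightarrow> (f has_derivative F p) (at p)"
    and "\<And>h. Ck_on k (\<lambda>p. F p h) U"
  shows "Ck_on (Suc k) f U"
proof -
  have "F p = frechet_derivative f (at p)" if "p \<in> U" for p
    using frechet_derivative_at[OF assms(2)[OF that]] .
  then have "Ck_on k (\<lambda>p. frechet_derivative f (at p) h) U" for h
    by (intro Ck_on_cong[OF \<open>open U\<close> assms(3)]) simp
  then show ?thesis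
    using assms(2) by (auto intro: differentiableI)
qed

lemma Ck_on_Suc_imp: "Ck_on (Suc k) f U \<Longrightarrow> Ck_on k f U"
proof (induction k arbitrary: f)
  case 0
  then show ?case
    by (auto intro!: differentiable_imp_continuous_on differentiable_at_imp_differentiable_on)
next
  case (Suc k)
  then show ?case by (auto simp del: Ck_on.simps(1))
qed

lemma Ck_on_subset: "Ck_on k f U \<Longrightarrow> V \<subseteq> U \<Longrightarrow> Ck_on k f V"
  by (induction k arbitrary: f) (auto intro: continuous_on_subset)

lemma Ck_on_locally:
  assumes "\<And>p. p \<in> U \<Longrightarrow> \<exists>V. open V \<and> p \<in> V \<and> Ck_on k f V"
  shows "Ck_on k f U"
  using assms
proof (induction k arbitrary: f)
  case 0
  show ?case
    unfolding Ck_on.simps continuous_on_eq_continuous_within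
  proof
    fix p assume "p \<in> U"
    with 0 obtain V where "open V" "p \<in> V" "continuous_on V f" by auto
    then have "isCont f p" by (simp add: continuous_on_eq_continuous_at)
    then show "continuous (at p within U) f"
      by (rule continuous_at_imp_continuous_within)
  qed
next
  case (Suc k)
  have "Ck_on k (\<lambda>p. frechet_derivative f (at p) h) U" for h
    by (rule Suc.IH) (use Suc.prems in fastforce)
  moreover have "f differentiable (at p)" if "p \<in> U" for p
    using Suc.prems[OF that] by auto
  ultimately show ?case by simp
qed

lemma Ck_on_const: "open U \<Longrightarrow> Ck_on k (\<lambda>p. c) U"
  by (induction k arbitrary: c) (auto intro!: Ck_on_derivI)

lemma Ck_on_bounded_linear:
  assumes "bounded_linear L" "open U" "Ck_on k f U"
  shows "Ck_on k (\<lambda>p. L (f p)) U"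
  using assms(3)
proof (induction k arbitrary: f)
  case 0
  then show ?case using bounded_linear.continuous_on[OF assms(1)] by auto
next
  case (Suc k)
  show ?case
    by (rule Ck_on_derivI[OF \<open>open U\<close> bounded_linear.has_derivative[OF assms(1) Ck_on_SucD(1)[OF Suc.prems]]
          Suc.IH[OF Ck_on_SucD(2)[OF Suc.prems]]])
qed

lemma Ck_on_add:
  assumes "open U" "Ck_on k f U" "Ck_on k g U"
  shows "Ck_on k (\<lambda>p. f p + g p) U"
  using assms(2,3)
proof (induction k arbitrary: f g)
  case 0
  then show ?case by (auto intro: continuous_intros)
next
  case (Suc k)
  show ?case
    by (rule Ck_on_derivI[OF \<open>open U\<close> has_derivative_add[OF Ck_on_SucD(1)[OF Suc.prems(1)] Ck_on_SucD(1)[OF Suc.prems(2)]]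
          Suc.IH[OF Ck_on_SucD(2)[OF Suc.prems(1)] Ck_on_SucD(2)[OF Suc.prems(2)]]])
qed

text \<open>By the Leibniz rule the derivative is a sum of two such products, in which one factor has been
  differentiated and the other is as smooth as before, which is more than the induction needs.\<close>

lemma Ck_on_bilinear:
  assumes "bounded_bilinear B" "open U" "Ck_on k f U" "Ck_on k g U"
  shows "Ck_on k (\<lambda>p. B (f p) (g p)) U"
  using assms(3,4)
proof (induction k arbitrary: f g)
  case 0
  then show ?case using bounded_bilinear.continuous_on[OF assms(1)] by auto
next
  case (Suc k)
  have "Ck_on k (\<lambda>p. B (f p) (frechet_derivative g (at p) h) + B (frechet_derivative f (at p) h) (g p)) U" for h
    by (intro Ck_on_add \<open>open U\<close> Suc.IH Ck_on_SucD(2)[OF Suc.prems(1)] Ck_on_SucD(2)[OF Suc.prems(2)]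
        Ck_on_Suc_imp[OF Suc.prems(1)] Ck_on_Suc_imp[OF Suc.prems(2)])
  with Suc.prems show ?case
    by (intro Ck_on_derivI[OF \<open>open U\<close> bounded_bilinear.FDERIV[OF assms(1) Ck_on_SucD(1)[OF Suc.prems(1)] Ck_on_SucD(1)[OF Suc.prems(2)]]])
qed

lemma Ck_on_sum:
  assumes "open U" "\<And>i. i \<in> I \<Longrightarrow> Ck_on k (f i) U"
  shows "Ck_on k (\<lambda>p. \<Sum>i\<in>I. f i p) U"
  using assms(2) by (induction I rule: infinite_finite_induct) (auto intro: Ck_on_const Ck_on_add \<open>open U\<close>)

lemma Ck_on_prod:
  fixes f :: "'i \<Rightarrow> 'a::euclidean_space \<Rightarrow> real"
  assumes "open U" "\<And>i. i \<in> I \<Longrightarrow> Ck_on k (f i) U"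
  shows "Ck_on k (\<lambda>p. \<Prod>i\<in>I. f i p) U"
  using assms(2) by (induction I rule: infinite_finite_induct)
    (auto intro: Ck_on_const Ck_on_bilinear[OF bounded_bilinear_mult] \<open>open U\<close>)

text \<open>The derivative \<open>- f' / f\<^sup>2\<close> is a product of inverses and of \<open>f'\<close>, and the induction hypothesis applies
  to the inverses.\<close>

lemma Ck_on_inverse:
  fixes f :: "'a::euclidean_space \<Rightarrow> real"
  assumes "open U" "Ck_on k f U" "\<And>p. p \<in> U \<Longrightarrow> f p \<noteq> 0"
  shows "Ck_on k (\<lambda>p. inverse (f p)) U"
  using assms(2)
proof (induction k)
  case 0
  then show ?case using assms(3) by (auto intro: continuous_intros)
next
  case (Suc k)
  note inv = Suc.IH[OF Ck_on_Suc_imp[OF Suc.prems]]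
  have "Ck_on k (\<lambda>p. - (inverse (f p) * frechet_derivative f (at p) h * inverse (f p))) U" for h
    by (intro Ck_on_bounded_linear[OF bounded_linear_minus[OF bounded_linear_ident]]
        Ck_on_bilinear[OF bounded_bilinear_mult] \<open>open U\<close> inv Ck_on_SucD(2)[OF Suc.prems])
  moreover have "((\<lambda>p. inverse (f p)) has_derivative
      (\<lambda>h. - (inverse (f p) * frechet_derivative f (at p) h * inverse (f p)))) (at p)" if "p \<in> U" for p
    by (rule Deriv.has_derivative_inverse[OF assms(3)[OF that] Ck_on_SucD(1)[OF Suc.prems that]])
  ultimately show ?case
    by (intro Ck_on_derivI[OF \<open>open U\<close>])
qed

text \<open>The chain rule gives the derivative in direction \<open>h\<close> as the derivative of \<open>f\<close> at \<open>g p\<close> in a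
  direction that depends on \<open>p\<close>. Expanding this direction in the basis leaves only derivatives of
  \<open>f\<close> in fixed directions, composed with \<open>g\<close>, to which the induction hypothesis applies.\<close>

lemma Ck_on_compose:
  fixes f :: "'b::euclidean_space \<Rightarrow> 'c::real_normed_vector" and g :: "'a::euclidean_space \<Rightarrow> 'b"
  assumes "open U" "Ck_on k f V" "Ck_on k g U" "g ` U \<subseteq> V"
  shows "Ck_on k (\<lambda>p. f (g p)) U"
  using assms(2,3)
proof (induction k arbitrary: f)
  case 0
  then show ?case using assms(4) by (auto intro: continuous_on_compose2)
next
  case (Suc k)
  let ?F = "\<lambda>p h. frechet_derivative f (at (g p)) (frechet_derivative g (at p) h)"
  have der: "((\<lambda>p. f (g p)) has_derivative ?F p) (at p)" if "p \<in> U" for p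
  proof -
    have "g p \<in> V" using that assms(4) by auto
    from diff_chain_at[OF Ck_on_SucD(1)[OF Suc.prems(2) that] Ck_on_SucD(1)[OF Suc.prems(1) this]]
    show ?thesis by (simp add: o_def)
  qed
  have "Ck_on k (\<lambda>p. ?F p h) U" for h
  proof (rule Ck_on_cong[OF \<open>open U\<close>])
    show "Ck_on k (\<lambda>p. \<Sum>b\<in>Basis. (frechet_derivative g (at p) h \<bullet> b) *\<^sub>R frechet_derivative f (at (g p)) b) U"
      by (intro Ck_on_sum Ck_on_bilinear[OF bounded_bilinear_scaleR] \<open>open U\<close>
          Ck_on_bounded_linear[OF bounded_linear_inner_left] Ck_on_SucD(2)[OF Suc.prems(2)]
          Suc.IH Ck_on_SucD(2)[OF Suc.prems(1)] Ck_on_Suc_imp[OF Suc.prems(2)])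
  next
    fix p assume "p \<in> U"
    then have "g p \<in> V" using assms(4) by auto
    from Ck_on_SucD(1)[OF Suc.prems(1) this] interpret L: bounded_linear "frechet_derivative f (at (g p))"
      by (rule has_derivative_bounded_linear)
    have "?F p h = frechet_derivative f (at (g p)) (\<Sum>b\<in>Basis. (frechet_derivative g (at p) h \<bullet> b) *\<^sub>R b)"
      by (simp add: euclidean_representation)
    then show "(\<Sum>b\<in>Basis. (frechet_derivative g (at p) h \<bullet> b) *\<^sub>R frechet_derivative f (at (g p)) b) = ?F p h"
      by (simp add: L.sum L.scaleR)
  qed
  then show ?case by (intro Ck_on_derivI[OF \<open>open U\<close> der])
qed

named_theorems smooth_rules

lemma smooth_on_cong:
  "open U \<Longrightarrow> smooth_on f U \<Longrightarrow> (\<And>p. p \<in> U \<Longrightarrow> f p = g p) \<Longrightarrow> smooth_on g U"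
  unfolding smooth_on_def using Ck_on_cong by blast

lemma smooth_on_subset: "smooth_on f U \<Longrightarrow> V \<subseteq> U \<Longrightarrow> smooth_on f V"
  unfolding smooth_on_def using Ck_on_subset by blast

lemma smooth_on_locally:
  assumes "\<And>p. p \<in> U \<Longrightarrow> \<exists>V. open V \<and> p \<in> V \<and> smooth_on f V"
  shows "smooth_on f U"
  using assms unfolding smooth_on_def by (metis Ck_on_locally)

lemma smooth_on_imp_continuous_on: "smooth_on f U \<Longrightarrow> continuous_on U f"
  unfolding smooth_on_def by (metis Ck_on.simps(1))

lemma smooth_on_has_derivative:
  "smooth_on f U \<Longrightarrow> p \<in> U \<Longrightarrow> (f has_derivative frechet_derivative f (at p)) (at p)"
  unfolding smooth_on_def using Ck_on_SucD(1) by blast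

lemma smooth_on_frechet_derivative:
  "smooth_on f U \<Longrightarrow> smooth_on (\<lambda>p. frechet_derivative f (at p) h) U"
  unfolding smooth_on_def using Ck_on_SucD(2) by blast

lemma smooth_on_const [smooth_rules]: "open U \<Longrightarrow> smooth_on (\<lambda>p. c) U"
  unfolding smooth_on_def by (simp add: Ck_on_const)

lemma smooth_on_bounded_linear:
  "bounded_linear L \<Longrightarrow> open U \<Longrightarrow> smooth_on f U \<Longrightarrow> smooth_on (\<lambda>p. L (f p)) U"
  unfolding smooth_on_def by (simp add: Ck_on_bounded_linear)

lemma smooth_on_bilinear:
  "bounded_bilinear B \<Longrightarrow> open U \<Longrightarrow> smooth_on f U \<Longrightarrow> smooth_on g U \<Longrightarrow> smooth_on (\<lambda>p. B (f p) (g p)) U"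
  unfolding smooth_on_def by (simp add: Ck_on_bilinear)

lemma smooth_on_add [smooth_rules]:
  "open U \<Longrightarrow> smooth_on f U \<Longrightarrow> smooth_on g U \<Longrightarrow> smooth_on (\<lambda>p. f p + g p) U"
  unfolding smooth_on_def by (simp add: Ck_on_add)

lemma smooth_on_sum [smooth_rules]:
  "open U \<Longrightarrow> (\<And>i. i \<in> I \<Longrightarrow> smooth_on (f i) U) \<Longrightarrow> smooth_on (\<lambda>p. \<Sum>i\<in>I. f i p) U"
  unfolding smooth_on_def by (simp add: Ck_on_sum)

lemma smooth_on_prod [smooth_rules]:
  fixes f :: "'i \<Rightarrow> 'a::euclidean_space \<Rightarrow> real"
  shows "open U \<Longrightarrow> (\<And>i. i \<in> I \<Longrightarrow> smooth_on (f i) U) \<Longrightarrow> smooth_on (\<lambda>p. \<Prod>i\<in>I. f i p) U"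
  unfolding smooth_on_def by (simp add: Ck_on_prod)

lemmas smooth_on_minus [smooth_rules] = smooth_on_bounded_linear[OF bounded_linear_minus[OF bounded_linear_ident]]
lemmas smooth_on_nth [smooth_rules] = smooth_on_bounded_linear[OF bounded_linear_vec_nth]
lemmas smooth_on_mult [smooth_rules] = smooth_on_bilinear[OF bounded_bilinear_mult]
lemmas smooth_on_scaleR [smooth_rules] = smooth_on_bilinear[OF bounded_bilinear_scaleR]
lemmas smooth_on_inner [smooth_rules] = smooth_on_bilinear[OF bounded_bilinear_inner]

lemma smooth_on_diff [smooth_rules]:
  "open U \<Longrightarrow> smooth_on f U \<Longrightarrow> smooth_on g U \<Longrightarrow> smooth_on (\<lambda>p. f p - g p) U"
  using smooth_on_add[of U f "\<lambda>p. - g p"] smooth_on_minus[of U g] by simp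

lemma smooth_on_inverse [smooth_rules]:
  fixes f :: "'a::euclidean_space \<Rightarrow> real"
  shows "open U \<Longrightarrow> smooth_on f U \<Longrightarrow> (\<And>p. p \<in> U \<Longrightarrow> f p \<noteq> 0) \<Longrightarrow> smooth_on (\<lambda>p. inverse (f p)) U"
  unfolding smooth_on_def by (simp add: Ck_on_inverse)

lemma smooth_on_divide [smooth_rules]:
  fixes f g :: "'a::euclidean_space \<Rightarrow> real"
  shows "open U \<Longrightarrow> smooth_on f U \<Longrightarrow> smooth_on g U \<Longrightarrow> (\<And>p. p \<in> U \<Longrightarrow> g p \<noteq> 0) \<Longrightarrow> smooth_on (\<lambda>p. f p / g p) U"
  unfolding divide_inverse by (intro smooth_rules)

lemma smooth_on_compose:
  fixes f :: "'b::euclidean_space \<Rightarrow> 'c::real_normed_vector" and g :: "'a::euclidean_space \<Rightarrow> 'b"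
  shows "open U \<Longrightarrow> smooth_on f V \<Longrightarrow> smooth_on g U \<Longrightarrow> g ` U \<subseteq> V \<Longrightarrow> smooth_on (\<lambda>p. f (g p)) U"
  unfolding smooth_on_def by (metis Ck_on_compose)

lemma smooth_on_linear:
  assumes "bounded_linear L" "open U"
  shows "smooth_on L U"
  unfolding smooth_on_def
proof
  fix k show "Ck_on k L U"
  proof (cases k)
    case 0
    then show ?thesis using assms(1) by (simp add: linear_continuous_on)
  next
    case (Suc m)
    show ?thesis unfolding Suc
      by (rule Ck_on_derivI[OF \<open>open U\<close> bounded_linear_imp_has_derivative[OF assms(1)] Ck_on_const[OF \<open>open U\<close>]])
  qed
qed

lemmas smooth_on_id [smooth_rules] = smooth_on_linear[OF bounded_linear_ident]

lemma smooth_on_vec_iff: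
  fixes f :: "'a::euclidean_space \<Rightarrow> real^'n"
  assumes "open U"
  shows "smooth_on f U \<longleftrightarrow> (\<forall>i. smooth_on (\<lambda>p. f p $ i) U)"
proof
  assume "smooth_on f U" then show "\<forall>i. smooth_on (\<lambda>p. f p $ i) U"
    by (intro allI smooth_rules assms)
next
  assume *: "\<forall>i. smooth_on (\<lambda>p. f p $ i) U"
  have eq: "(\<lambda>p. \<Sum>i\<in>UNIV. (f p $ i) *\<^sub>R axis i 1) = f"
    unfolding scalar_mult_eq_scaleR[symmetric] basis_expansion ..
  have "smooth_on (\<lambda>p. \<Sum>i\<in>UNIV. (f p $ i) *\<^sub>R axis i (1::real)) U"
    by (intro smooth_on_sum smooth_on_scaleR smooth_on_const assms *[rule_format])
  then show "smooth_on f U" unfolding eq .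
qed

text \<open>The real derivative of a holomorphic map is multiplication by its complex derivative, which is
  holomorphic again. This makes the Riemann map smooth in the real sense.\<close>

lemma smooth_on_holomorphic:
  assumes "f holomorphic_on U" "open U"
  shows "smooth_on f U"
  unfolding smooth_on_def
proof
  fix k from assms(1) show "Ck_on k f U"
  proof (induction k arbitrary: f)
    case 0
    then show ?case by (simp add: holomorphic_on_imp_continuous_on)
  next
    case (Suc k)
    have "(f has_derivative (*) (deriv f p)) (at p)" if "p \<in> U" for p
      using holomorphic_derivI[OF Suc.prems \<open>open U\<close> that] by (simp add: has_field_derivative_def)
    moreover have "Ck_on k (\<lambda>p. deriv f p * h) U" for h
      by (rule Suc.IH) (intro holomorphic_on_mult holomorphic_deriv holomorphic_on_const Suc.prems \<open>open U\<close>)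
    ultimately show ?case by (intro Ck_on_derivI[OF \<open>open U\<close>, of f "\<lambda>p. (*) (deriv f p)"])
  qed
qed

section \<open>A smooth cutoff function on the line\<close>

text \<open>The powers of \<open>1 / t\<close> make the family closed under differentiation: each derivative is a linear
  combination of two members. The member for \<open>m = 0\<close> is the classical smooth function that is flat at
  the origin.\<close>

definition flat_exp :: "nat \<Rightarrow> real \<Rightarrow> real" where
  "flat_exp m t = (if t > 0 then (1 / t) ^ m * exp (- (1 / t)) else 0)"

lemma flat_exp_tendsto_0: "((\<lambda>t. flat_exp m t) \<longlongrightarrow> 0) (at 0)"
proof (rule filterlim_split_at)
  show "(flat_exp m \<longlongrightarrow> 0) (at_left 0)"
    by (rule tendsto_eventually) (auto simp: eventually_at_filter flat_exp_def)
  have "((\<lambda>y. y ^ m / exp y) \<longlongrightarrow> 0) (at_top :: real filter)"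
    by (rule tendsto_power_div_exp_0)
  then have "((\<lambda>t. inverse t ^ m / exp (inverse t)) \<longlongrightarrow> (0::real)) (at_right 0)"
    by (rule filterlim_compose[OF _ filterlim_inverse_at_top_right])
  then show "(flat_exp m \<longlongrightarrow> 0) (at_right 0)"
  proof (rule Lim_transform_eventually)
    have "inverse t ^ m / exp (inverse t) = flat_exp m t" if "t > 0" for t
      using that by (simp add: flat_exp_def exp_minus divide_inverse)
    then show "\<forall>\<^sub>F t in at_right 0. inverse t ^ m / exp (inverse t) = flat_exp m t"
      by (simp add: eventually_at_filter)
  qed
qed

text \<open>At \<open>0\<close> the difference quotient of one member is the next one, which tends to \<open>0\<close>.\<close>

lemma flat_exp_has_derivative:
  "(flat_exp m has_real_derivative flat_exp (m + 2) t - m * flat_exp (m + 1) t) (at t)"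
proof (cases t "0::real" rule: linorder_cases)
  case less
  have "((\<lambda>t. 0) has_real_derivative 0) (at t)" by simp
  then have "(flat_exp m has_real_derivative 0) (at t)"
    by (rule has_field_derivative_transform_within_open[where S = "{..<0}"])
      (use less in \<open>auto simp: flat_exp_def\<close>)
  then show ?thesis using less by (simp add: flat_exp_def)
next
  case equal
  have "flat_exp (m + 1) h = (flat_exp m h - flat_exp m 0) / h" for h
    by (simp add: flat_exp_def)
  then show ?thesis
    using flat_exp_tendsto_0[of "m + 1"] unfolding equal DERIV_def by (simp add: flat_exp_def)
next
  case greater
  have "((\<lambda>t. (1 / t) ^ m * exp (- (1 / t))) has_real_derivative
      (1 / t) ^ (m + 2) * exp (- (1 / t)) - m * ((1 / t) ^ (m + 1) * exp (- (1 / t)))) (at t)"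
  proof (cases m)
    case 0
    then show ?thesis
      using greater by (auto intro!: derivative_eq_intros simp: field_simps power2_eq_square)
  next
    case (Suc l)
    have "((\<lambda>t. 1 / t) has_real_derivative - (1 / t)\<^sup>2) (at t)"
      using greater by (auto intro!: derivative_eq_intros simp: field_simps power2_eq_square)
    from DERIV_mult[OF DERIV_power_Suc[OF this, of l] DERIV_fun_exp[OF DERIV_minus[OF this]]]
    show ?thesis
      unfolding Suc by (rule DERIV_cong) (simp add: algebra_simps power2_eq_square)
  qed
  then have "(flat_exp m has_real_derivative
      (1 / t) ^ (m + 2) * exp (- (1 / t)) - m * ((1 / t) ^ (m + 1) * exp (- (1 / t)))) (at t)"
    by (rule has_field_derivative_transform_within_open[where S = "{0<..}"])
      (use greater in \<open>auto simp: flat_exp_def\<close>)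
  then show ?thesis using greater by (simp add: flat_exp_def)
qed

lemma smooth_on_flat_exp: "smooth_on (flat_exp m) UNIV"
  unfolding smooth_on_def
proof
  fix k show "Ck_on k (flat_exp m) UNIV"
  proof (induction k arbitrary: m)
    case 0
    show ?case
      by (auto intro!: continuous_at_imp_continuous_on DERIV_isCont flat_exp_has_derivative)
  next
    case (Suc k)
    have "Ck_on k (\<lambda>t. h *\<^sub>R (flat_exp (m + 2) t + (- real m) *\<^sub>R flat_exp (m + 1) t)) UNIV" for h
      by (intro Ck_on_bounded_linear[OF bounded_linear_scaleR_right] Ck_on_add Suc.IH open_UNIV)
    moreover have "(flat_exp m has_derivative
        (\<lambda>h. h *\<^sub>R (flat_exp (m + 2) t + (- real m) *\<^sub>R flat_exp (m + 1) t))) (at t)" for t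
      using flat_exp_has_derivative[of m t] unfolding has_field_derivative_def
      by (rule has_derivative_eq_rhs) (simp add: fun_eq_iff)
    ultimately show ?case
      by (intro Ck_on_derivI[OF open_UNIV])
  qed
qed

lemma smooth_cutoff_exists:
  obtains \<psi> :: "real \<Rightarrow> real" where "smooth_on \<psi> UNIV" "\<And>t. 0 \<le> \<psi> t \<and> \<psi> t \<le> 1"
    "\<And>t. t \<le> 0 \<Longrightarrow> \<psi> t = 1" "\<And>t. 1 \<le> t \<Longrightarrow> \<psi> t = 0"
proof -
  let ?g = "flat_exp 0"
  define \<psi> where "\<psi> t = ?g (1 - t) / (?g t + ?g (1 - t))" for t
  have nonneg: "?g t \<ge> 0" and pos: "t > 0 \<Longrightarrow> ?g t > 0" for t
    by (auto simp: flat_exp_def)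
  have sum_pos: "?g t + ?g (1 - t) > 0" for t
    using nonneg[of t] nonneg[of "1 - t"] pos[of t] pos[of "1 - t"] by (cases "t > 0") linarith+
  show thesis
  proof
    show "smooth_on \<psi> UNIV"
      unfolding \<psi>_def using less_imp_neq[OF sum_pos, symmetric]
      by (intro smooth_rules open_UNIV smooth_on_flat_exp smooth_on_compose[OF open_UNIV smooth_on_flat_exp]) auto
    show "0 \<le> \<psi> t \<and> \<psi> t \<le> 1" for t
      using sum_pos[of t] nonneg[of t] nonneg[of "1 - t"] by (auto simp: \<psi>_def)
    show "\<psi> t = 1" if "t \<le> 0" for t
      using sum_pos[of t] that by (simp add: \<psi>_def flat_exp_def)
    show "\<psi> t = 0" if "1 \<le> t" for t
      using that by (simp add: \<psi>_def flat_exp_def)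
  qed
qed

section \<open>Rotating unit normal fields\<close>

text \<open>The rotation that takes \<open>f\<close> to \<open>g\<close> in their plane maps \<open>v\<close> to
  \<open>v - (v \<bullet> (f + g) / (1 + f \<bullet> g)) (f + g) + 2 (f \<bullet> v) g\<close>; for \<open>v\<close> orthogonal to \<open>f\<close> this is \<open>e'\<close>. The
  denominator vanishes exactly for antipodal vectors.\<close>

lemma rotate_unit_normal:
  fixes f g e :: "'b::real_inner"
  assumes "norm f = 1" "norm g = 1" "norm e = 1" "e \<bullet> f = 0" "f \<bullet> g \<noteq> -1"
  defines "e' \<equiv> e - (e \<bullet> g / (1 + f \<bullet> g)) *\<^sub>R (f + g)"
  shows "norm e' = 1" "e' \<bullet> g = 0" "f = g \<Longrightarrow> e' = e"
proof -
  have ff: "f \<bullet> f = 1" "g \<bullet> g = 1" "e \<bullet> e = 1"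
    using assms by (simp_all add: dot_square_norm)
  have nz: "1 + f \<bullet> g \<noteq> 0" using assms(5) by linarith
  show "e' \<bullet> g = 0"
  proof -
    have "e' \<bullet> g = e \<bullet> g - (e \<bullet> g / (1 + f \<bullet> g)) * (1 + f \<bullet> g)"
      by (simp add: e'_def ff inner_diff_left inner_add_left add.commute)
    then show ?thesis using nz by simp
  qed
  define c where "c = e \<bullet> g / (1 + f \<bullet> g)"
  have eg: "e \<bullet> g = c * (1 + f \<bullet> g)" using nz by (simp add: c_def)
  have "e' \<bullet> e' = e \<bullet> e - 2 * c * (e \<bullet> f + e \<bullet> g) + c * c * (f \<bullet> f + 2 * (f \<bullet> g) + g \<bullet> g)"
    unfolding e'_def c_def[symmetric] by (simp add: inner_simps inner_commute algebra_simps)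
  also have "\<dots> = 1"
    unfolding ff eg assms(4) by (simp add: algebra_simps)
  finally show "norm e' = 1" by (simp add: norm_eq_sqrt_inner)
  show "e' = e" if "f = g" using that assms(4) by (simp add: e'_def)
qed

definition unit_normal_field :: "'a::euclidean_space set \<Rightarrow> ('a \<Rightarrow> 'b::euclidean_space) \<Rightarrow> ('a \<Rightarrow> 'b) \<Rightarrow> bool" where
  "unit_normal_field D n e \<longleftrightarrow> smooth_on e D \<and> (\<forall>p\<in>D. norm (e p) = 1 \<and> e p \<bullet> n p = 0)"

text \<open>Unit vectors at distance less than \<open>2\<close> are not antipodal, so the rotation is defined at every
  point. That nothing changes where \<open>f\<close> and \<open>g\<close> agree makes the infinite process below locally
  stationary.\<close>

lemma unit_normal_field_step:
  fixes f g :: "'a::euclidean_space \<Rightarrow> 'b::euclidean_space"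
  assumes "open D" "smooth_on f D" "smooth_on g D" "unit_normal_field D f e"
    and "\<And>p. p \<in> D \<Longrightarrow> norm (f p) = 1" "\<And>p. p \<in> D \<Longrightarrow> norm (g p) = 1"
    and near: "\<And>p. p \<in> D \<Longrightarrow> norm (f p - g p) < 2"
  obtains e' where "unit_normal_field D g e'" "\<And>p. p \<in> D \<Longrightarrow> f p = g p \<Longrightarrow> e' p = e p"
proof
  let ?e = "\<lambda>p. e p - (e p \<bullet> g p / (1 + f p \<bullet> g p)) *\<^sub>R (f p + g p)"
  have nz: "f p \<bullet> g p \<noteq> -1" if "p \<in> D" for p
  proof
    assume "f p \<bullet> g p = -1"
    moreover have "f p \<bullet> f p = 1" "g p \<bullet> g p = 1"
      using assms(5,6)[OF that] by (simp_all add: dot_square_norm)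
    ultimately have "(norm (f p - g p))\<^sup>2 = 2\<^sup>2"
      by (simp add: power2_norm_eq_inner inner_simps inner_commute)
    then have "norm (f p - g p) = 2" by (rule power2_eq_imp_eq) auto
    then show False using near[OF that] by simp
  qed
  then have nz': "1 + f p \<bullet> g p \<noteq> 0" if "p \<in> D" for p using that by (metis add.commute add_eq_0_iff)
  have e: "smooth_on e D" "\<And>p. p \<in> D \<Longrightarrow> norm (e p) = 1" "\<And>p. p \<in> D \<Longrightarrow> e p \<bullet> f p = 0"
    using assms(4) by (auto simp: unit_normal_field_def)
  have "smooth_on ?e D"
    by (intro smooth_rules assms(1,2,3) e(1) nz')
  then show "unit_normal_field D g ?e"
    using rotate_unit_normal(1,2)[OF assms(5,6) e(2,3) nz] by (simp add: unit_normal_field_def)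
  show "?e p = e p" if "p \<in> D" "f p = g p" for p
    using rotate_unit_normal(3)[OF assms(5,6) e(2,3) nz] that by simp
qed

section \<open>Unit normal fields on starlike domains\<close>

text \<open>The pullback of \<open>n\<close> under \<open>p \<mapsto> s p *\<^sub>R p\<close>: for \<open>s = 0\<close> it is constant, and it agrees with \<open>n\<close>
  where \<open>s = 1\<close>.\<close>

definition scaled :: "('a::euclidean_space \<Rightarrow> 'b::euclidean_space) \<Rightarrow> ('a \<Rightarrow> real) \<Rightarrow> 'a \<Rightarrow> 'b" where
  "scaled n s p = n (s p *\<^sub>R p)"

text \<open>The sublevel sets of the smooth function \<open>q\<close> exhaust \<open>D\<close> by compact sets. The plane and the open
  disc are both of this kind, which gives the two cases of the Riemann mapping theorem a common
  treatment.\<close>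

locale starlike_exhaustion =
  fixes D :: "'a::euclidean_space set" and q :: "'a \<Rightarrow> real"
  assumes open_D: "open D"
    and star: "\<And>t p. p \<in> D \<Longrightarrow> 0 \<le> t \<Longrightarrow> t \<le> 1 \<Longrightarrow> t *\<^sub>R p \<in> D"
    and smooth_q: "smooth_on q D"
    and compact_sublevel: "\<And>c. compact {p \<in> D. q p \<le> c}"
begin

text \<open>The vanishing where \<open>q \<ge> c\<close> confines the scaled points \<open>s p *\<^sub>R p\<close> to a compact set.\<close>

definition scaling :: "real \<Rightarrow> ('a \<Rightarrow> real) \<Rightarrow> bool" where
  "scaling c s \<longleftrightarrow> smooth_on s D \<and> (\<forall>p\<in>D. 0 \<le> s p \<and> s p \<le> 1 \<and> (q p \<ge> c \<longrightarrow> s p = 0))"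

lemma smooth_on_scaled:
  assumes "smooth_on n D" "smooth_on s D" "\<And>p. p \<in> D \<Longrightarrow> 0 \<le> s p \<and> s p \<le> 1"
  shows "smooth_on (scaled n s) D"
  unfolding scaled_def
  by (rule smooth_on_compose[OF open_D assms(1)])
    (use assms star in \<open>auto intro!: smooth_rules open_D\<close>)

text \<open>The affine path from \<open>s\<close> to \<open>s'\<close> moves points only where \<open>q < c\<close>, and all scaled points stay in a
  compact part \<open>K\<close> of \<open>D\<close>, where \<open>n\<close> is uniformly continuous. Hence finitely many equal steps keep
  successive pullbacks of \<open>n\<close> at distance less than \<open>2\<close>.\<close>

lemma unit_normal_field_between_scalings:
  fixes n :: "'a \<Rightarrow> 'b::euclidean_space"
  assumes n: "smooth_on n D" "\<And>p. p \<in> D \<Longrightarrow> norm (n p) = 1"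
    and s: "scaling c s" and s': "scaling c s'"
    and e: "unit_normal_field D (scaled n s) e"
  shows "\<exists>e'. unit_normal_field D (scaled n s') e' \<and> (\<forall>p\<in>D. s p = s' p \<longrightarrow> e' p = e p)"
proof -
  define K where "K = (\<lambda>(t, p). t *\<^sub>R p) ` ({0..1} \<times> {p \<in> D. q p \<le> c})"
  have "compact K"
    unfolding K_def
    by (intro compact_continuous_image compact_Times compact_Icc compact_sublevel)
      (auto simp: split_beta intro!: continuous_intros)
  moreover have "K \<subseteq> D" unfolding K_def using star by auto
  ultimately have "uniformly_continuous_on K n"
    using smooth_on_imp_continuous_on[OF n(1)] compact_uniformly_continuous continuous_on_subset by blast
  then obtain \<delta> where \<delta>: "\<delta> > 0" "\<And>x y. x \<in> K \<Longrightarrow> y \<in> K \<Longrightarrow> dist x y < \<delta> \<Longrightarrow> dist (n x) (n y) < 2"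
    unfolding uniformly_continuous_on_def by (metis zero_less_numeral)
  obtain M where M: "M > 0" "\<And>p. p \<in> D \<Longrightarrow> q p \<le> c \<Longrightarrow> norm p \<le> M"
    using compact_imp_bounded[OF compact_sublevel[of c]] unfolding bounded_pos by auto
  \<comment> \<open>The \<open>N\<close> steps move a point of norm at most \<open>M\<close> by at most \<open>M / N < \<delta>\<close> each.\<close>
  obtain N where N: "M / \<delta> < real N" using reals_Archimedean2 by blast
  have "0 < real N" using N M(1) \<delta>(1) by (meson divide_pos_pos less_trans)
  define \<sigma> where "\<sigma> i p = s p + (real i / real N) * (s' p - s p)" for i p
  have bounds: "0 \<le> \<sigma> i p \<and> \<sigma> i p \<le> 1" if "i \<le> N" "p \<in> D" for i p
  proof -
    have "0 \<le> real i / real N" "real i / real N \<le> 1" using that \<open>0 < real N\<close> by auto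
    moreover have "\<sigma> i p = (1 - real i / real N) * s p + (real i / real N) * s' p"
      unfolding \<sigma>_def by algebra
    ultimately show ?thesis
      using s s' that convex_bound_le[of "s p" 1 "s' p" "1 - real i / real N" "real i / real N"]
      by (auto simp: scaling_def)
  qed
  have smooth_\<sigma>: "smooth_on (\<sigma> i) D" for i
    using s s' unfolding \<sigma>_def scaling_def by (intro smooth_rules open_D) auto
  have close: "norm (scaled n (\<sigma> i) p - scaled n (\<sigma> (Suc i)) p) < 2" if "Suc i \<le> N" "p \<in> D" for i p
  proof (cases "q p \<le> c")
    case False
    then have "s p = 0" "s' p = 0" using s s' that by (auto simp: scaling_def)
    then show ?thesis by (simp add: scaled_def \<sigma>_def)
  next
    case True
    have in_K: "\<sigma> j p *\<^sub>R p \<in> K" if "j \<le> N" for j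
      using bounds[OF that \<open>p \<in> D\<close>] True \<open>p \<in> D\<close> unfolding K_def by force
    have "\<sigma> i p - \<sigma> (Suc i) p = (s p - s' p) / real N"
      using \<open>0 < real N\<close> by (simp add: \<sigma>_def field_simps)
    moreover have "\<bar>s p - s' p\<bar> \<le> 1" using s s' \<open>p \<in> D\<close> unfolding scaling_def by fastforce
    ultimately have "\<bar>\<sigma> i p - \<sigma> (Suc i) p\<bar> \<le> 1 / real N"
      using \<open>0 < real N\<close> by (simp add: divide_right_mono)
    then have "dist (\<sigma> i p *\<^sub>R p) (\<sigma> (Suc i) p *\<^sub>R p) \<le> 1 / real N * M"
      unfolding dist_norm scaleR_left_diff_distrib[symmetric] norm_scaleR
      using M True \<open>p \<in> D\<close> \<open>0 < real N\<close> by (intro mult_mono) auto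
    also have "\<dots> < \<delta>" using N \<delta>(1) \<open>0 < real N\<close> by (simp add: field_simps)
    finally show ?thesis
      using \<delta>(2)[OF in_K in_K] that by (simp add: scaled_def dist_norm)
  qed
  have "\<exists>e'. unit_normal_field D (scaled n (\<sigma> i)) e' \<and> (\<forall>p\<in>D. s p = s' p \<longrightarrow> e' p = e p)" if "i \<le> N" for i
    using that
  proof (induction i)
    case 0
    have "\<sigma> 0 = s" by (simp add: \<sigma>_def fun_eq_iff)
    with e show ?case by auto
  next
    case (Suc i)
    then obtain e1 where e1: "unit_normal_field D (scaled n (\<sigma> i)) e1" "\<forall>p\<in>D. s p = s' p \<longrightarrow> e1 p = e p"
      by auto
    have sm: "smooth_on (scaled n (\<sigma> j)) D" "p \<in> D \<Longrightarrow> norm (scaled n (\<sigma> j) p) = 1" if "j \<le> N" for j p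
      using smooth_on_scaled[OF n(1) smooth_\<sigma> bounds[OF that]] n(2) star bounds[OF that]
      by (auto simp: scaled_def)
    obtain e2 where e2: "unit_normal_field D (scaled n (\<sigma> (Suc i))) e2"
      "\<And>p. p \<in> D \<Longrightarrow> scaled n (\<sigma> i) p = scaled n (\<sigma> (Suc i)) p \<Longrightarrow> e2 p = e1 p"
      using Suc.prems close[OF Suc.prems]
      by (elim unit_normal_field_step[OF open_D sm(1) sm(1) e1(1) sm(2) sm(2), rotated -1]) auto
    have "e2 p = e p" if "p \<in> D" "s p = s' p" for p
      using e2(2)[OF that(1)] e1(2) that by (simp add: scaled_def \<sigma>_def)
    with e2(1) show ?case by blast
  qed
  moreover have "\<sigma> N = s'" using \<open>0 < real N\<close> by (auto simp: \<sigma>_def fun_eq_iff)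
  ultimately show ?thesis by (metis order_refl)
qed

text \<open>The scalings \<open>s j\<close> start from \<open>0\<close>, where any fixed unit vector orthogonal to \<open>n 0\<close> serves, and are
  \<open>1\<close> on the sublevel set \<open>q \<le> j\<close> for \<open>j > 0\<close>. The fields \<open>e j\<close> therefore no longer change on this set
  from stage \<open>j\<close> on, and there they are normal to \<open>n\<close> itself.\<close>

lemma unit_normal_field_exists:
  fixes n :: "'a \<Rightarrow> 'b::euclidean_space"
  assumes n: "smooth_on n D" "\<And>p. p \<in> D \<Longrightarrow> norm (n p) = 1" and dim: "2 \<le> DIM('b)"
  shows "\<exists>e. unit_normal_field D n e"
proof -
  obtain \<psi> :: "real \<Rightarrow> real" where \<psi>: "smooth_on \<psi> UNIV" "\<And>t. 0 \<le> \<psi> t \<and> \<psi> t \<le> 1"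
    "\<And>t. t \<le> 0 \<Longrightarrow> \<psi> t = 1" "\<And>t. 1 \<le> t \<Longrightarrow> \<psi> t = 0"
    using smooth_cutoff_exists by blast
  define s where "s j p = (if j = 0 then 0 else \<psi> (q p - real j))" for j :: nat and p
  have s_scaling: "scaling c (s j)" if "real j + 1 \<le> c" for j c
  proof -
    have "smooth_on (s j) D"
      unfolding s_def
      by (cases "j = 0") (auto intro!: smooth_rules open_D smooth_on_compose[OF open_D \<psi>(1)] smooth_q)
    then show ?thesis using that \<psi> by (auto simp: scaling_def s_def)
  qed
  have s_one: "s j p = 1" if "0 < j" "q p \<le> real j" for j p
    using that \<psi>(3) by (simp add: s_def)
  define good where "good j e \<longleftrightarrow> unit_normal_field D (scaled n (s j)) e" for j e
  have "\<exists>e0. good 0 e0"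
  proof -
    obtain e0 :: 'b where "orthogonal (n 0) e0" "e0 \<noteq> 0"
      using orthogonal_to_vector_exists[OF dim] by blast
    then have "good 0 (\<lambda>p. e0 /\<^sub>R norm e0)"
      by (auto simp: good_def unit_normal_field_def scaled_def s_def orthogonal_def inner_commute
          intro!: smooth_rules open_D)
    then show ?thesis by blast
  qed
  moreover have "\<exists>e'. good (Suc j) e' \<and> (\<forall>p\<in>D. s j p = s (Suc j) p \<longrightarrow> e' p = e p)" if "good j e" for j e
    unfolding good_def
    by (rule unit_normal_field_between_scalings[OF n s_scaling s_scaling that[unfolded good_def], where c = "real j + 2"]) auto
  ultimately obtain e where e: "\<And>j. good j (e j)"
    "\<And>j. \<forall>p\<in>D. s j p = s (Suc j) p \<longrightarrow> e (Suc j) p = e j p"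
    using dependent_nat_choice[of good "\<lambda>j e e'. \<forall>p\<in>D. s j p = s (Suc j) p \<longrightarrow> e' p = e p"] by metis
  \<comment> \<open>The successor makes \<open>stage\<close> positive; \<open>s 0\<close> is \<open>0\<close> and not \<open>1\<close> on its sublevel set.\<close>
  define stage where "stage p = Suc (nat \<lceil>q p\<rceil>)" for p
  have stage: "q p \<le> real (stage p)" "0 < stage p" for p
    unfolding stage_def by linarith+
  define E where "E p = e (stage p) p" for p
  have stationary: "e (stage p + k) p = E p" if "p \<in> D" for p k
  proof (induction k)
    case (Suc k)
    have "s (stage p + k) p = s (Suc (stage p + k)) p"
      using stage[of p] by (simp add: s_one)
    with e(2) that have "e (Suc (stage p + k)) p = e (stage p + k) p" by blast
    with Suc show ?case by simp
  qed (simp add: E_def)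
  have "smooth_on E D"
  proof (rule smooth_on_locally)
    fix p assume "p \<in> D"
    \<comment> \<open>On this neighbourhood of \<open>p\<close> the limit is the single field \<open>e (stage p)\<close>.\<close>
    let ?V = "{y \<in> D. q y < real (stage p)}"
    have "open ?V"
      using continuous_open_preimage[OF smooth_on_imp_continuous_on[OF smooth_q] open_D open_lessThan[of "real (stage p)"]]
      by (simp add: vimage_def Int_def lessThan_def)
    moreover have "p \<in> ?V" using \<open>p \<in> D\<close> unfolding stage_def by (simp, linarith)
    moreover have "E y = e (stage p) y" if "y \<in> ?V" for y
    proof -
      \<comment> \<open>On the neighbourhood \<open>stage y\<close> may exceed \<open>stage p\<close> by one, hence the comparison at
        \<open>Suc (stage p)\<close>, where both fields have become stationary.\<close>
      have "stage y \<le> Suc (stage p)" using that unfolding stage_def by (simp add: nat_le_iff ceiling_le_iff) linarith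
      have "s (stage p) y = s (Suc (stage p)) y"
        using that stage[of p] by (simp add: s_one)
      then have "e (Suc (stage p)) y = e (stage p) y" using e(2) that by blast
      then show ?thesis
        using stationary[of y "Suc (stage p) - stage y"] \<open>stage y \<le> Suc (stage p)\<close> that by simp
    qed
    moreover have "smooth_on (e (stage p)) ?V"
      using e(1)[of "stage p"] smooth_on_subset[of _ D ?V] by (auto simp: good_def unit_normal_field_def)
    ultimately have "smooth_on E ?V" using smooth_on_cong[of ?V "e (stage p)" E] by metis
    with \<open>open ?V\<close> \<open>p \<in> ?V\<close> show "\<exists>V. open V \<and> p \<in> V \<and> smooth_on E V" by blast
  qed
  moreover have "norm (E p) = 1 \<and> E p \<bullet> n p = 0" if "p \<in> D" for p
    using e(1)[of "stage p"] that s_one[OF stage(2,1)]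
    by (auto simp: good_def unit_normal_field_def scaled_def E_def)
  ultimately show ?thesis by (auto simp: unit_normal_field_def)
qed

end

section \<open>Unit normal fields on simply connected plane domains\<close>

lemma unit_normal_field_pullback:
  assumes "open U" "smooth_on f U" "f ` U \<subseteq> D" "unit_normal_field D (\<lambda>w. n (g w)) e"
    and "\<And>p. p \<in> U \<Longrightarrow> g (f p) = p"
  shows "unit_normal_field U n (\<lambda>p. e (f p))"
proof -
  have "norm (e (f p)) = 1 \<and> e (f p) \<bullet> n p = 0" if "p \<in> U" for p
  proof -
    have "f p \<in> D" using assms(3) that by auto
    with assms(4) have "norm (e (f p)) = 1 \<and> e (f p) \<bullet> n (g (f p)) = 0"
      by (auto simp: unit_normal_field_def)
    with assms(5)[OF that] show ?thesis by simp
  qed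
  then show ?thesis
    using assms smooth_on_compose[of U e D f] by (auto simp: unit_normal_field_def)
qed

lemma starlike_exhaustion_UNIV: "starlike_exhaustion (UNIV :: 'a::euclidean_space set) (\<lambda>p. p \<bullet> p)"
proof
  show "compact {p \<in> (UNIV :: 'a set). p \<bullet> p \<le> c}" for c
  proof (cases "c \<ge> 0")
    case True
    then have "{p \<in> (UNIV :: 'a set). p \<bullet> p \<le> c} = cball 0 (sqrt c)"
      by (auto simp: norm_eq_sqrt_inner)
    then show ?thesis by simp
  next
    case False
    then have "\<not> p \<bullet> p \<le> c" for p :: 'a
      using inner_ge_zero[of p] by linarith
    then show ?thesis by simp
  qed
qed (auto intro!: smooth_rules)

text \<open>The exhaustion function must tend to infinity at the boundary and be smooth at the centre, where
  the norm is not; hence the square of the norm.\<close>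

lemma starlike_exhaustion_ball:
  "starlike_exhaustion (ball 0 1 :: 'a::euclidean_space set) (\<lambda>p. 1 / (1 - p \<bullet> p))"
proof
  have less: "p \<bullet> p < 1" if "p \<in> ball 0 1" for p :: 'a
    using that by (simp add: norm_eq_sqrt_inner)
  show "smooth_on (\<lambda>p. 1 / (1 - p \<bullet> p)) (ball 0 1 :: 'a set)"
    using less by (intro smooth_rules open_ball) fastforce
  show "t *\<^sub>R p \<in> ball 0 1" if "p \<in> ball 0 1" "0 \<le> t" "t \<le> 1" for t and p :: 'a
    using that mult_left_le_one_le[of "norm p" t] by simp
  show "compact {p \<in> (ball 0 1 :: 'a set). 1 / (1 - p \<bullet> p) \<le> c}" for c
  proof -
    have "{p \<in> (ball 0 1 :: 'a set). 1 / (1 - p \<bullet> p) \<le> c} = (if c > 0 then {p. 1 / c \<le> 1 - p \<bullet> p} else {})"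
    proof -
      have "p \<in> ball 0 1 \<and> 1 / (1 - p \<bullet> p) \<le> c \<longleftrightarrow> c > 0 \<and> 1 / c \<le> 1 - p \<bullet> p" for p :: 'a
      proof -
        have "p \<in> ball 0 1 \<longleftrightarrow> 0 < 1 - p \<bullet> p" by (simp add: norm_eq_sqrt_inner)
        moreover have "0 < t \<and> 1 / t \<le> c \<longleftrightarrow> c > 0 \<and> 1 / c \<le> t" for t
          by (smt (verit) divide_le_eq mult.commute zero_less_divide_iff pos_divide_le_eq)
        ultimately show ?thesis by metis
      qed
      then show ?thesis by auto
    qed
    moreover have "compact {p :: 'a. 1 / c \<le> 1 - p \<bullet> p}"
    proof -
      have "{p :: 'a. 1 / c \<le> 1 - p \<bullet> p} = {p \<in> UNIV. p \<bullet> p \<le> 1 - 1 / c}" by auto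
      then show ?thesis
        using starlike_exhaustion.compact_sublevel[OF starlike_exhaustion_UNIV, of "1 - 1 / c"] by (simp only:)
    qed
    ultimately show ?thesis by simp
  qed
qed simp

text \<open>By the Riemann mapping theorem the domain is empty, the plane or biholomorphic to the unit disc;
  in the last case the field found on the disc is pulled back.\<close>

lemma unit_normal_field_on_simply_connected:
  fixes n :: "complex \<Rightarrow> 'b::euclidean_space"
  assumes "open S" "simply_connected S" "smooth_on n S" "\<And>p. p \<in> S \<Longrightarrow> norm (n p) = 1" "2 \<le> DIM('b)"
  shows "\<exists>e. unit_normal_field S n e"
proof -
  consider "S = {}" | "S = UNIV" | f g where "f holomorphic_on S" "g holomorphic_on ball 0 1"
    "\<forall>z\<in>S. f z \<in> ball 0 1 \<and> g (f z) = z" "\<forall>z\<in>ball 0 1. g z \<in> S"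
    using assms(2) unfolding simply_connected_eq_biholomorphic_to_disc[OF \<open>open S\<close>] by blast
  then show ?thesis
  proof cases
    case 1
    then show ?thesis using smooth_on_const[of S 0] by (auto simp: unit_normal_field_def)
  next
    case 2
    then show ?thesis
      using starlike_exhaustion.unit_normal_field_exists[OF starlike_exhaustion_UNIV] assms by metis
  next
    case 3
    have "smooth_on (\<lambda>w. n (g w)) (ball 0 1)"
      using 3 by (intro smooth_on_compose[OF open_ball assms(3)] smooth_on_holomorphic) auto
    moreover have "norm (n (g w)) = 1" if "w \<in> ball 0 1" for w
      using 3(4) assms(4) that by blast
    ultimately obtain e where "unit_normal_field (ball 0 1) (\<lambda>w. n (g w)) e"
      using starlike_exhaustion.unit_normal_field_exists[OF starlike_exhaustion_ball] assms(5) by blast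
    then have "unit_normal_field S n (\<lambda>z. e (f z))"
      using 3 by (intro unit_normal_field_pullback[OF \<open>open S\<close> smooth_on_holomorphic[OF 3(1) \<open>open S\<close>]]) auto
    then show ?thesis by blast
  qed
qed

lemma unit_normal_field_on_simply_connected_plane:
  fixes n :: "real \<times> real \<Rightarrow> 'b::euclidean_space"
  assumes "open U" "simply_connected U" "smooth_on n U" "\<And>p. p \<in> U \<Longrightarrow> norm (n p) = 1" "2 \<le> DIM('b)"
  shows "\<exists>e. unit_normal_field U n e"
proof -
  define f where "f = (\<lambda>p :: real \<times> real. fst p *\<^sub>R (1::complex) + snd p *\<^sub>R \<i>)"
  define g where "g = (\<lambda>z. (Re z, Im z))"
  have gf: "g (f p) = p" and fg: "f (g z) = z" for p z
    by (auto simp: f_def g_def complex_eq_iff)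
  have bl: "bounded_linear f" "bounded_linear g"
    unfolding f_def g_def
    by (intro bounded_linear_add bounded_linear_scaleR_left[THEN bounded_linear_compose]
        bounded_linear_fst bounded_linear_snd bounded_linear_Pair bounded_linear_Re bounded_linear_Im)+
  have "z \<in> f ` U" if "g z \<in> U" for z
    using that fg[of z] by (metis imageI)
  then have eq: "f ` U = g -` U" by (auto simp: gf)
  have "open (f ` U)"
    unfolding eq using bl(2) \<open>open U\<close> by (intro open_vimage linear_continuous_on)
  moreover have "U homeomorphic f ` U"
    unfolding homeomorphic_def homeomorphism_def using bl gf
    by (intro exI[of _ f] exI[of _ g]) (auto simp: image_image linear_continuous_on)
  then have "simply_connected (f ` U)" using assms(2) homeomorphic_simply_connected_eq by blast
  moreover have "smooth_on (\<lambda>w. n (g w)) (f ` U)"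
    by (rule smooth_on_compose[OF \<open>open (f ` U)\<close> assms(3) smooth_on_linear[OF bl(2) \<open>open (f ` U)\<close>]])
      (simp add: image_image gf)
  moreover have "norm (n (g w)) = 1" if "w \<in> f ` U" for w
    using that assms(4) gf by (elim imageE) simp
  ultimately obtain e where "unit_normal_field (f ` U) (\<lambda>w. n (g w)) e"
    using unit_normal_field_on_simply_connected[OF _ _ _ _ assms(5)] by blast
  then have "unit_normal_field U n (\<lambda>p. e (f p))"
    using unit_normal_field_pullback[OF \<open>open U\<close> smooth_on_linear[OF bl(1) \<open>open U\<close>] order_refl] gf by blast
  then show ?thesis by blast
qed

section \<open>Boosts trivialize the tangent bundle of hyperbolic space\<close>

text \<open>The Lorentz boost that takes \<open>(1, 0, 0, 0)\<close> to \<open>x\<close>, restricted to the complement \<open>real^3\<close> of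
  \<open>(1, 0, 0, 0)\<close>. It adds to \<open>(0, y)\<close> the multiple of \<open>(1, 0, 0, 0) + x\<close> that makes the result orthogonal
  to \<open>x\<close>.\<close>

definition boost :: "real^4 \<Rightarrow> real^3 \<Rightarrow> real^4" where
  "boost x y = (let s = x$2 * y$1 + x$3 * y$2 + x$4 * y$3; c = s / (1 + x$1)
     in vector [s, y$1 + c * x$2, y$2 + c * x$3, y$3 + c * x$4])"

text \<open>The inverse of the boost, on the pseudo-orthogonal complement of \<open>x\<close>: the multiple of
  \<open>(1, 0, 0, 0) + x\<close> that cancels the first coordinate is subtracted.\<close>

definition unboost :: "real^4 \<Rightarrow> real^4 \<Rightarrow> real^3" where
  "unboost x w = (let c = w$1 / (1 + x$1)
     in vector [w$2 - c * x$2, w$3 - c * x$3, w$4 - c * x$4])"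

text \<open>Calling the reciprocal of \<open>1 + x$1\<close> by a name turns the identities for boosts into polynomial
  consequences of the last two equations. The last one is the equation of \<open>H3\<close>, divided by
  \<open>1 + x$1\<close>.\<close>

lemma H3_boost_factor:
  assumes "x \<in> H3"
  obtains r where "\<And>t. t / (1 + x$1) = t * r" "r * (1 + x$1) = 1"
    "r * ((x$2)\<^sup>2 + (x$3)\<^sup>2 + (x$4)\<^sup>2) = x$1 - 1"
proof
  have "1 + x$1 \<noteq> 0" and sq: "(x$2)\<^sup>2 + (x$3)\<^sup>2 + (x$4)\<^sup>2 = (x$1 - 1) * (1 + x$1)"
    using assms by (auto simp: H3_def pinner_def power2_eq_square algebra_simps)
  then show "inverse (1 + x$1) * (1 + x$1) = 1" by simp
  show "inverse (1 + x$1) * ((x$2)\<^sup>2 + (x$3)\<^sup>2 + (x$4)\<^sup>2) = x$1 - 1"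
    unfolding sq using \<open>1 + x$1 \<noteq> 0\<close> by simp
qed (simp add: divide_inverse)

lemma pinner_boost:
  assumes "x \<in> H3"
  shows "pinner (boost x y) (boost x z) = y \<bullet> z"
proof -
  obtain r where r: "\<And>t. t / (1 + x$1) = t * r" "r * (1 + x$1) = 1"
    "r * ((x$2)\<^sup>2 + (x$3)\<^sup>2 + (x$4)\<^sup>2) = x$1 - 1"
    using H3_boost_factor[OF assms] by blast
  show ?thesis
    using r(2,3) unfolding pinner_def boost_def Let_def vector_4 r(1) inner_vec_def sum_3 inner_real_def
    by algebra
qed

lemma pinner_base_boost:
  assumes "x \<in> H3"
  shows "pinner x (boost x y) = 0"
proof -
  obtain r where r: "\<And>t. t / (1 + x$1) = t * r" "r * (1 + x$1) = 1"
    "r * ((x$2)\<^sup>2 + (x$3)\<^sup>2 + (x$4)\<^sup>2) = x$1 - 1"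
    using H3_boost_factor[OF assms] by blast
  show ?thesis
    using r(2,3) unfolding pinner_def boost_def Let_def vector_4 r(1)
    by algebra
qed

lemma boost_unboost:
  assumes "x \<in> H3" "pinner x w = 0"
  shows "boost x (unboost x w) = w"
proof -
  obtain r where r: "\<And>t. t / (1 + x$1) = t * r" "r * (1 + x$1) = 1"
    "r * ((x$2)\<^sup>2 + (x$3)\<^sup>2 + (x$4)\<^sup>2) = x$1 - 1"
    using H3_boost_factor[OF assms(1)] by blast
  define s where "s = x$2 * unboost x w $ 1 + x$3 * unboost x w $ 2 + x$4 * unboost x w $ 3"
  have "s = w$1"
    using r(2,3) assms(2) unfolding s_def pinner_def unboost_def Let_def vector_3 r(1)
    by algebra
  then have "boost x (unboost x w) = vector [w$1, unboost x w $ 1 + w$1 / (1 + x$1) * x$2,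
      unboost x w $ 2 + w$1 / (1 + x$1) * x$3, unboost x w $ 3 + w$1 / (1 + x$1) * x$4]"
    unfolding boost_def s_def[symmetric] Let_def by simp
  then show ?thesis
    by (simp add: vec_eq_iff forall_4 vector_4 vector_3 unboost_def)
qed

lemma inner_unboost:
  assumes "x \<in> H3" "pinner x v = 0" "pinner x w = 0"
  shows "unboost x v \<bullet> unboost x w = pinner v w"
  using pinner_boost[OF assms(1), of "unboost x v" "unboost x w"] assms by (simp add: boost_unboost)

lemma boost_linear: "boost x (a *\<^sub>R y + b *\<^sub>R z) = a *\<^sub>R boost x y + b *\<^sub>R boost x z"
  by (simp add: boost_def Let_def vec_eq_iff forall_4 vector_4 add_divide_distrib algebra_simps)

lemma H3_denominator: "x \<in> H3 \<Longrightarrow> 1 + x$1 \<noteq> 0"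
  by (simp add: H3_def)

section \<open>Smoothness of the boosted fields and of the pseudo vector product\<close>

lemma smooth_on_vector_3:
  fixes a b c :: "'a::euclidean_space \<Rightarrow> real"
  assumes "open U" "smooth_on a U" "smooth_on b U" "smooth_on c U"
  shows "smooth_on (\<lambda>p. vector [a p, b p, c p] :: real^3) U"
  using assms by (simp add: smooth_on_vec_iff forall_3 vector_3)

lemma smooth_on_vector_4:
  fixes a b c d :: "'a::euclidean_space \<Rightarrow> real"
  assumes "open U" "smooth_on a U" "smooth_on b U" "smooth_on c U" "smooth_on d U"
  shows "smooth_on (\<lambda>p. vector [a p, b p, c p, d p] :: real^4) U"
  using assms by (simp add: smooth_on_vec_iff forall_4 vector_4)

lemma smooth_on_boost:
  assumes "open U" "smooth_on x U" "smooth_on y U" "x ` U \<subseteq> H3"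
  shows "smooth_on (\<lambda>p. boost (x p) (y p)) U"
  unfolding boost_def Let_def using assms(4) H3_denominator
  by (intro smooth_on_vector_4 smooth_rules assms) auto

lemma smooth_on_unboost:
  assumes "open U" "smooth_on x U" "smooth_on w U" "x ` U \<subseteq> H3"
  shows "smooth_on (\<lambda>p. unboost (x p) (w p)) U"
  unfolding unboost_def Let_def using assms(4) H3_denominator
  by (intro smooth_on_vector_3 smooth_rules assms) auto

lemma smooth_on_cross3:
  "open U \<Longrightarrow> smooth_on y U \<Longrightarrow> smooth_on z U \<Longrightarrow> smooth_on (\<lambda>p. cross3 (y p) (z p)) U"
  unfolding cross3_def by (intro smooth_on_vector_3 smooth_rules)

text \<open>By its defining property the product is a determinant, hence polynomial in the coordinates.\<close>

lemma smooth_on_pinner_pcross: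
  assumes "open U" "smooth_on a U" "smooth_on b U" "smooth_on c U" "smooth_on d U"
  shows "smooth_on (\<lambda>p. pinner (a p) (pcross (b p) (c p) (d p))) U"
proof -
  have "smooth_on (\<lambda>p. (vector [a p, b p, c p, d p] :: real^4^4) $ i) U" for i
    using exhaust_4[of i] assms by (auto simp: vector_4)
  then have "smooth_on (\<lambda>p. (vector [a p, b p, c p, d p] :: real^4^4) $ i $ j) U" for i j
    using smooth_on_nth[OF \<open>open U\<close>] by blast
  then show ?thesis
    unfolding pinner_pcross det_def
    by (intro smooth_on_sum smooth_on_mult smooth_on_const smooth_on_prod \<open>open U\<close>)
qed

lemma pinner_self_pcross: "pinner x (pcross x y z) = 0"
proof -
  have "row 1 (vector [x, x, y, z] :: real^4^4) = row 2 (vector [x, x, y, z] :: real^4^4)"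
    by (simp add: row_def vector_4)
  then show ?thesis
    unfolding pinner_pcross by (intro det_identical_rows[of "1::4" 2]) auto
qed

lemma smooth_on_partial_u:
  assumes "open U" "smooth_on f U"
  shows "smooth_on (partial_u f) U"
proof (rule smooth_on_cong[OF \<open>open U\<close> smooth_on_frechet_derivative[OF assms(2), of "(1, 0)"]])
  fix p assume "p \<in> U"
  have "((\<lambda>s. f (s, snd p)) has_vector_derivative frechet_derivative f (at p) (1, 0)) (at (fst p))"
  proof -
    have "((\<lambda>s. (s, snd p)) has_vector_derivative (1, 0)) (at (fst p))"
      by (auto intro!: derivative_eq_intros simp: has_vector_derivative_def)
    from vector_derivative_diff_chain_within[OF this, of f "frechet_derivative f (at p)"]
    show ?thesis
      using smooth_on_has_derivative[OF assms(2) \<open>p \<in> U\<close>] by (simp add: o_def has_derivative_at_withinI)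
  qed
  then show "frechet_derivative f (at p) (1, 0) = partial_u f p"
    unfolding partial_u_def by (rule vector_derivative_at[symmetric])
qed

lemma smooth_on_partial_v:
  assumes "open U" "smooth_on f U"
  shows "smooth_on (partial_v f) U"
proof (rule smooth_on_cong[OF \<open>open U\<close> smooth_on_frechet_derivative[OF assms(2), of "(0, 1)"]])
  fix p assume "p \<in> U"
  have "((\<lambda>t. f (fst p, t)) has_vector_derivative frechet_derivative f (at p) (0, 1)) (at (snd p))"
  proof -
    have "((\<lambda>t. (fst p, t)) has_vector_derivative (0, 1)) (at (snd p))"
      by (auto intro!: derivative_eq_intros simp: has_vector_derivative_def)
    from vector_derivative_diff_chain_within[OF this, of f "frechet_derivative f (at p)"]
    show ?thesis
      using smooth_on_has_derivative[OF assms(2) \<open>p \<in> U\<close>] by (simp add: o_def has_derivative_at_withinI)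
  qed
  then show "frechet_derivative f (at p) (0, 1) = partial_v f p"
    unfolding partial_v_def by (rule vector_derivative_at[symmetric])
qed

section \<open>Orthonormal frames and framed base surfaces\<close>

lemma norm_cross3_orthonormal:
  fixes y z :: "real^3"
  assumes "norm y = 1" "norm z = 1" "y \<bullet> z = 0"
  shows "norm (cross3 y z) = 1"
  using norm_cross_dot[of y z] assms by (simp add: power2_eq_1_iff) (smt (verit) norm_ge_zero)

text \<open>The remainder \<open>z\<close> of the expansion is orthogonal to \<open>n\<close>, to \<open>e\<close> and to their cross product \<open>b\<close>. By the
  double cross product formula \<open>z \<times> b\<close> vanishes as well, and a vector both parallel and orthogonal to
  the unit vector \<open>b\<close> is zero.\<close>

lemma orthonormal_expansion_in_plane:
  fixes e n y :: "real^3"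
  assumes "norm n = 1" "norm e = 1" "e \<bullet> n = 0" "y \<bullet> n = 0"
  shows "y = (y \<bullet> e) *\<^sub>R e + (y \<bullet> cross3 n e) *\<^sub>R cross3 n e"
proof -
  let ?b = "cross3 n e"
  have b: "norm ?b = 1" using norm_cross3_orthonormal[OF assms(1,2)] assms(3) by (simp add: inner_commute)
  define z where "z = y - (y \<bullet> e) *\<^sub>R e - (y \<bullet> ?b) *\<^sub>R ?b"
  have "z \<bullet> n = 0" "z \<bullet> e = 0" "z \<bullet> ?b = 0"
    using assms b inner_commute[of n e]
    by (auto simp: z_def inner_diff_left dot_cross_self dot_square_norm)
  moreover have "cross3 z ?b = (z \<bullet> e) *\<^sub>R n - (z \<bullet> n) *\<^sub>R e"
    by (simp add: cross3_def inner_vec_def sum_3 vec_eq_iff forall_3 vector_3 algebra_simps)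
  ultimately have "z = 0"
    using norm_and_cross_eq_0[of z ?b] b by auto
  then show ?thesis by (simp add: z_def algebra_simps)
qed

theorem theorem3p13:
  fixes U :: "(real \<times> real) set" and x :: "real \<times> real \<Rightarrow> real^4"
  assumes "open U" and "simply_connected U"
    and "smooth_on x U" and "x ` U \<subseteq> H3"
  shows "hyp_gen_framed_base_surface U x \<longleftrightarrow>
    (\<exists>n :: real \<times> real \<Rightarrow> real^4. smooth_on n U \<and> n ` U \<subseteq> S31 \<and>
      (\<forall>p\<in>U. pinner (x p) (n p) = 0 \<and>
        pinner (pcross (x p) (partial_u x p) (partial_v x p)) (n p) = 0))"
    (is "_ \<longleftrightarrow> ?normal")
proof
  have H: "x p \<in> H3" if "p \<in> U" for p using assms(4) that by auto
  let ?X = "\<lambda>p. pcross (x p) (partial_u x p) (partial_v x p)"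
  assume "hyp_gen_framed_base_surface U x"
  then obtain n1 n2 \<alpha> \<beta> where sm: "smooth_on n1 U" "smooth_on n2 U"
    and unit: "\<And>p. p \<in> U \<Longrightarrow> (n1 p, n2 p) \<in> Delta5"
    and orth: "\<And>p. p \<in> U \<Longrightarrow> pinner (x p) (n1 p) = 0" "\<And>p. p \<in> U \<Longrightarrow> pinner (x p) (n2 p) = 0"
    and X: "\<And>p. p \<in> U \<Longrightarrow> ?X p = \<alpha> p *\<^sub>R n1 p + \<beta> p *\<^sub>R n2 p"
    unfolding hyp_gen_framed_base_surface_def hyp_gen_framed_surface_def by blast
  define y1 where "y1 p = unboost (x p) (n1 p)" for p
  define y2 where "y2 p = unboost (x p) (n2 p)" for p
  have y: "norm (y1 p) = 1" "norm (y2 p) = 1" "y1 p \<bullet> y2 p = 0" if "p \<in> U" for p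
    using unit[OF that] H[OF that] orth[OF that]
    by (auto simp: y1_def y2_def norm_eq_1 inner_unboost Delta5_def S31_def)
  have boost_y: "boost (x p) (y1 p) = n1 p" "boost (x p) (y2 p) = n2 p" if "p \<in> U" for p
    using H[OF that] orth[OF that] by (auto simp: y1_def y2_def boost_unboost)
  define n where "n p = boost (x p) (cross3 (y1 p) (y2 p))" for p
  have "smooth_on n U"
    unfolding n_def y1_def y2_def
    by (intro smooth_on_boost smooth_on_cross3 smooth_on_unboost assms sm)
  moreover have "n p \<in> S31" "pinner (x p) (n p) = 0" if "p \<in> U" for p
    using norm_cross3_orthonormal[OF y[OF that]] H[OF that]
    by (auto simp: n_def S31_def pinner_boost pinner_base_boost norm_eq_1)
  moreover have "pinner (?X p) (n p) = 0" if "p \<in> U" for p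
  proof -
    have "?X p = boost (x p) (\<alpha> p *\<^sub>R y1 p + \<beta> p *\<^sub>R y2 p)"
      using X[OF that] boost_y[OF that] by (simp add: boost_linear)
    then show ?thesis
      using H[OF that] by (simp add: n_def pinner_boost inner_add_left dot_cross_self)
  qed
  ultimately show ?normal by (intro exI[of _ n]) auto
next
  have H: "x p \<in> H3" if "p \<in> U" for p using assms(4) that by auto
  let ?X = "\<lambda>p. pcross (x p) (partial_u x p) (partial_v x p)"
  assume ?normal
  then obtain n where n: "smooth_on n U" "\<And>p. p \<in> U \<Longrightarrow> pinner (n p) (n p) = 1"
    "\<And>p. p \<in> U \<Longrightarrow> pinner (x p) (n p) = 0" "\<And>p. p \<in> U \<Longrightarrow> pinner (?X p) (n p) = 0"
    unfolding S31_def by blast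
  define m where "m p = unboost (x p) (n p)" for p
  have m: "smooth_on m U" "\<And>p. p \<in> U \<Longrightarrow> norm (m p) = 1"
    unfolding m_def using smooth_on_unboost[OF assms(1,3) n(1) assms(4)] n(2,3) H
    by (auto simp: norm_eq_1 inner_unboost)
  then obtain e where "unit_normal_field U m e"
    using unit_normal_field_on_simply_connected_plane[OF assms(1,2)] by fastforce
  then have e: "smooth_on e U" "\<And>p. p \<in> U \<Longrightarrow> norm (e p) = 1" "\<And>p. p \<in> U \<Longrightarrow> e p \<bullet> m p = 0"
    by (auto simp: unit_normal_field_def)
  let ?b = "\<lambda>p. cross3 (m p) (e p)"
  have b: "norm (?b p) = 1" "e p \<bullet> ?b p = 0" if "p \<in> U" for p
    using norm_cross3_orthonormal[of "m p" "e p"] m(2) e(2,3) that by (auto simp: inner_commute dot_cross_self)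
  define n1 where "n1 p = boost (x p) (e p)" for p
  define n2 where "n2 p = boost (x p) (?b p)" for p
  have sm: "smooth_on n1 U" "smooth_on n2 U"
    unfolding n1_def n2_def by (intro smooth_on_boost smooth_on_cross3 assms m e)+
  have orthonormal: "(n1 p, n2 p) \<in> Delta5" "pinner (x p) (n1 p) = 0" "pinner (x p) (n2 p) = 0" if "p \<in> U" for p
    using H[OF that] e(2)[OF that] b[OF that]
    by (auto simp: n1_def n2_def Delta5_def S31_def pinner_boost pinner_base_boost norm_eq_1)
  \<comment> \<open>The coefficients are written as products with the frame because these are visibly smooth in \<open>p\<close>.\<close>
  have "?X p = pinner (n1 p) (?X p) *\<^sub>R n1 p + pinner (n2 p) (?X p) *\<^sub>R n2 p" if "p \<in> U" for p
  proof -
    note Hp = H[OF that]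
    define y where "y = unboost (x p) (?X p)"
    have X: "boost (x p) y = ?X p"
      unfolding y_def by (rule boost_unboost[OF Hp pinner_self_pcross])
    have "y \<bullet> m p = 0"
      using n(4)[OF that] inner_unboost[OF Hp pinner_self_pcross n(3)[OF that]] by (simp add: y_def m_def)
    then have "y = (y \<bullet> e p) *\<^sub>R e p + (y \<bullet> ?b p) *\<^sub>R ?b p"
      using orthonormal_expansion_in_plane[OF m(2) e(2,3)] that by blast
    then have "?X p = (y \<bullet> e p) *\<^sub>R n1 p + (y \<bullet> ?b p) *\<^sub>R n2 p"
      unfolding n1_def n2_def by (metis X boost_linear)
    moreover have "y \<bullet> e p = pinner (n1 p) (?X p)" "y \<bullet> ?b p = pinner (n2 p) (?X p)"
      unfolding X[symmetric] n1_def n2_def by (simp_all add: pinner_boost[OF Hp] inner_commute)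
    ultimately show ?thesis by simp
  qed
  moreover have "smooth_on (\<lambda>p. pinner (n1 p) (?X p)) U" "smooth_on (\<lambda>p. pinner (n2 p) (?X p)) U"
    by (intro smooth_on_pinner_pcross smooth_on_partial_u smooth_on_partial_v assms sm)+
  ultimately have "hyp_gen_framed_surface U x n1 n2"
    unfolding hyp_gen_framed_surface_def using assms(3) sm orthonormal H by blast
  then show "hyp_gen_framed_base_surface U x"
    unfolding hyp_gen_framed_base_surface_def using assms(3,4) by blast
qed

end
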